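(* For all integers $n\geq 0$ and $k\geq 0$, $$F_{n,2}(k)=\sum_{i=0}^{n}\binom{n}{i}\left[\sum_{l=0}^{i}l!\,S(i,l)\binom{k+l}{l}\right]2^{n-i},$$ where $S(i,l)$ denotes the Stirling number of the second kind.
   Context: For an integer $n\ge 0$ let $X_n=\{x_1,\ldots,x_n\}$ be an $n$-element set ($X_0=\emptyset$). For each integer $k\ge 0$ fix an arbitrary choice of $k$ real numbers ("spikes") $0<a_1<a_2<\cdots<a_k<1$, and set $a_0=0$, $a_{k+1}=1$. Consider fuzzy subsets of $X_n$ avoiding the spikes, i.e. maps $\mu:X_n\to[0,1]\setminus\{a_1,\ldots,a_k\}$. Two such fuzzy subsets $\mu,\nu$ are called equivalent ($\mu\sim\nu$) if for all $i=0,1,\ldots,k$ and all $x,y\in X_n$ (with $x=y$ allowed): (i) $\mu(x)=a_{k+1}$ if and only if $\nu(x)=a_{k+1}$; (ii) $a_{i+1}>\mu(x)\geq\mu(y)>a_i$ if and only if $a_{i+1}>\nu(x)\geq\nu(y)>a_i$; (iii) $\mu(x)=a_0$ if and only if $\nu(x)=a_0$. $F_{n,2}(k)$ denotes the number of equivalence classes of $\sim$ on the set of all maps $\mu:X_n\to[0,1]\setminus\{a_1,\ldots,a_k\}$ (both boundary values $0$ and $1$ allowed). For $n=0$ there is exactly one (empty) map, so $F_{0,2}(k)=1$. $S(i,l)$ is the number of partitions of an $i$-element set into $l$ non-empty blocks, with $S(0,0)=1$. *)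

theory Defs
  imports Complex_Main "HOL-Combinatorics.Stirling" "HOL-Library.Disjoint_Sets" "HOL-Library.FuncSet"
begin

text \<open>The spikes are \<open>a 1 < \<dots> < a k\<close>; \<open>a 0\<close> and \<open>a (Suc k)\<close> hold the conventional end
  values 0 and 1. Values of \<open>a\<close> beyond \<open>Suc k\<close> are irrelevant.\<close>

definition spikes :: "nat \<Rightarrow> (nat \<Rightarrow> real) \<Rightarrow> bool" where
  "spikes k a \<longleftrightarrow> a 0 = 0 \<and> a (Suc k) = 1 \<and> strict_mono_on {0..Suc k} a"

text \<open>Extensional functions are used so that maps with domain \<open>X\<close> are
  counted without multiplicity.\<close>

definition fuzzy_sets :: "nat \<Rightarrow> (nat \<Rightarrow> real) \<Rightarrow> 'a set \<Rightarrow> ('a \<Rightarrow> real) set" where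
  "fuzzy_sets k a X = X \<rightarrow>\<^sub>E ({0..1} - a ` {1..k})"

definition fuzzy_equiv :: "nat \<Rightarrow> (nat \<Rightarrow> real) \<Rightarrow> 'a set \<Rightarrow> ('a \<Rightarrow> real) \<Rightarrow> ('a \<Rightarrow> real) \<Rightarrow> bool" where
  "fuzzy_equiv k a X \<mu> \<nu> \<longleftrightarrow>
     (\<forall>i\<in>{0..k}. \<forall>x\<in>X. \<forall>y\<in>X.
        (\<mu> x = a (k + 1) \<longleftrightarrow> \<nu> x = a (k + 1)) \<and>
        ((a (i + 1) > \<mu> x \<and> \<mu> x \<ge> \<mu> y \<and> \<mu> y > a i) \<longleftrightarrow>
         (a (i + 1) > \<nu> x \<and> \<nu> x \<ge> \<nu> y \<and> \<nu> y > a i)) \<and>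
        (\<mu> x = a 0 \<longleftrightarrow> \<nu> x = a 0))"

definition fuzzy_rel :: "nat \<Rightarrow> (nat \<Rightarrow> real) \<Rightarrow> 'a set \<Rightarrow> (('a \<Rightarrow> real) \<times> ('a \<Rightarrow> real)) set" where
  "fuzzy_rel k a X =
     {(\<mu>, \<nu>). \<mu> \<in> fuzzy_sets k a X \<and> \<nu> \<in> fuzzy_sets k a X \<and> fuzzy_equiv k a X \<mu> \<nu>}"

lemma equiv_fuzzy_rel: "equiv (fuzzy_sets k a X) (fuzzy_rel k a X)"
proof (rule equivI)
  show "sym (fuzzy_rel k a X)"
    unfolding sym_def fuzzy_rel_def fuzzy_equiv_def by fast
  show "trans (fuzzy_rel k a X)"
    unfolding trans_def fuzzy_rel_def fuzzy_equiv_def by simp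
qed (auto simp: refl_on_def fuzzy_rel_def fuzzy_equiv_def)

definition F2 :: "nat \<Rightarrow> (nat \<Rightarrow> real) \<Rightarrow> 'a set \<Rightarrow> nat" where
  "F2 k a X = card (fuzzy_sets k a X // fuzzy_rel k a X)"

text \<open>The library defines \<^const>\<open>Stirling\<close> by its recurrence; the following lemma
  shows that it counts partitions into non-empty blocks.\<close>

lemma card_partition_on_eq_Stirling:
  fixes A :: "'a set"
  assumes "finite A"
  shows "card {P. partition_on A P \<and> card P = l} = Stirling (card A) l"
  using assms
proof (induction A arbitrary: l rule: finite_induct)
  case empty
  show ?case
  proof (cases l)
    case 0
    have "{P :: 'a set set. P = {} \<and> card P = 0} = {{}}" by auto
    then show ?thesis using 0 by (simp add: partition_on_empty)
  next
    case (Suc k)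
    then have "{P. partition_on ({} :: 'a set) P \<and> card P = l} = {}" by (auto simp: partition_on_empty)
    with Suc show ?thesis by (metis Stirling.simps(2) card.empty)
  qed
next
  case (insert x A)
  define parts where "parts m = {P. partition_on A P \<and> card P = m}" for m
  have finP: "finite P" if "partition_on A P" for P
    using that insert.hyps(1) by (metis finite_UnionD partition_onD1)
  have finQ: "finite Q" if "partition_on (insert x A) Q" for Q
    using that insert.hyps(1) by (metis finite_UnionD finite_insert partition_onD1)
  have fparts: "finite (parts m)" for m
    by (rule finite_subset[of _ "Pow (Pow A)"])
       (auto simp: parts_def partition_on_def insert.hyps)
  have notx: "x \<notin> B" if "partition_on A P" "B \<in> P" for P B
    using that insert.hyps(2) by (auto simp: partition_on_def)
  show ?case
  proof (cases l)
    case 0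
    have False if "partition_on (insert x A) P" "card P = 0" for P
      using finQ[OF that(1)] that by (auto simp: partition_on_def)
    then have "{P. partition_on (insert x A) P \<and> card P = l} = {}"
      using 0 by blast
    then show ?thesis using 0 insert.hyps by (metis Stirling.simps(3) card.empty card_insert_disjoint)
  next
    case (Suc k)
    define f where "f P = insert {x} P" for P :: "'a set set"
    define g where "g = (\<lambda>(P, B). insert (insert x B) (P - {B}) :: 'a set set)"
    define r where "r Q = (\<lambda>B. B - {x}) ` Q - {{}}" for Q :: "'a set set"
    have f_in: "partition_on (insert x A) (f P)" "card (f P) = Suc k" "{x} \<in> f P" "f P - {{x}} = P"
      if "P \<in> parts k" for P
    proof -
      have P: "partition_on A P" "card P = k" using that by (auto simp: parts_def)
      have nx: "{x} \<notin> P" using notx[OF P(1)] by blast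
      show "partition_on (insert x A) (f P)"
        using P(1) notx[OF P(1)] unfolding partition_on_def f_def disjoint_def by auto
      show "card (f P) = Suc k" "{x} \<in> f P" "f P - {{x}} = P"
        using nx P finP by (auto simp: f_def)
    qed
    have g_in: "partition_on (insert x A) (g (P, B)) \<and> card (g (P, B)) = Suc k \<and>
      {x} \<notin> g (P, B) \<and> r (g (P, B)) = P \<and> {C \<in> g (P, B). x \<in> C} = {insert x B}"
      if "P \<in> parts (Suc k)" "B \<in> P" for P B
    proof -
      have P: "partition_on A P" "card P = Suc k" using that by (auto simp: parts_def)
      have D: "\<Union>P = A" "\<And>C D. C \<in> P \<Longrightarrow> D \<in> P \<Longrightarrow> C \<noteq> D \<Longrightarrow> C \<inter> D = {}" "{} \<notin> P"
        using P(1) by (auto simp: partition_on_def disjoint_def)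
      have nx: "\<And>C. C \<in> P \<Longrightarrow> x \<notin> C" using notx[OF P(1)] by blast
      have minus: "C - {x} = C" if "C \<in> P" for C using nx[OF that] by blast
      have 1: "partition_on (insert x A) (g (P, B))"
      proof (rule partition_onI)
        show "\<Union> (g (P, B)) = insert x A" using D(1) \<open>B \<in> P\<close> by (auto simp: g_def)
        show "{} \<notin> g (P, B)" using D(3) by (auto simp: g_def)
        have new: "disjnt (insert x B) C" if "C \<in> P - {B}" for C
          using D(2)[of C B] that nx \<open>B \<in> P\<close> by (auto simp: disjnt_def)
        have old: "disjnt C D" if "C \<in> P - {B}" "D \<in> P - {B}" "C \<noteq> D" for C D
          using D(2) that by (simp add: disjnt_def)
        fix p q assume pq: "p \<in> g (P, B)" "q \<in> g (P, B)" "p \<noteq> q"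
        then consider "p = insert x B" "q \<in> P - {B}" | "p \<in> P - {B}" "q = insert x B"
          | "p \<in> P - {B}" "q \<in> P - {B}" by (auto simp: g_def)
        then show "disjnt p q" using pq(3) by cases (use new old disjnt_sym in blast)+
      qed
      have "insert x B \<notin> P - {B}" using nx[of "insert x B"] by auto
      then have 2: "card (g (P, B)) = Suc k"
        using P finP[OF P(1)] \<open>B \<in> P\<close> by (simp add: g_def)
      have "B \<noteq> {}" using D(3) \<open>B \<in> P\<close> by blast
      then have 3: "{x} \<notin> g (P, B)" using nx \<open>B \<in> P\<close> by (auto simp: g_def)
      have "(\<lambda>C. C - {x}) ` g (P, B) = insert B (P - {B})"
      proof -
        have "(\<lambda>C. C - {x}) ` (P - {B}) = (\<lambda>C. C) ` (P - {B})"
          by (rule image_cong) (auto simp only: minus Diff_iff)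
        moreover have "insert x B - {x} = B" using nx[OF \<open>B \<in> P\<close>] by blast
        ultimately show ?thesis by (simp only: g_def case_prod_conv image_insert image_ident)
      qed
      then have 4: "r (g (P, B)) = P" using D(3) \<open>B \<in> P\<close>
        unfolding r_def by (simp only: insert_Diff) blast
      have 5: "{C \<in> g (P, B). x \<in> C} = {insert x B}" using nx by (auto simp: g_def)
      show ?thesis by (intro conjI 1 2 3 4 5)
    qed
    have eq: "{Q. partition_on (insert x A) Q \<and> card Q = l} =
      f ` parts k \<union> g ` (SIGMA P:parts (Suc k). P)" (is "?L = ?R")
    proof
      have "f P \<in> ?L" if "P \<in> parts k" for P
        using f_in(1,2)[OF that] Suc by simp
      moreover have "g (P, B) \<in> ?L" if "P \<in> parts (Suc k)" "B \<in> P" for P B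
        using g_in[OF that] Suc by simp
      ultimately show "?R \<subseteq> ?L" by blast
      show "?L \<subseteq> ?R"
      proof
        fix Q assume "Q \<in> ?L"
        then have Q: "partition_on (insert x A) Q" "card Q = Suc k" using Suc by auto
        have D: "\<Union>Q = insert x A" "\<And>C D. C \<in> Q \<Longrightarrow> D \<in> Q \<Longrightarrow> C \<noteq> D \<Longrightarrow> C \<inter> D = {}" "{} \<notin> Q"
          using Q(1) by (auto simp: partition_on_def disjoint_def)
        obtain C where C: "C \<in> Q" "x \<in> C" using D(1) by blast
        have nx: "x \<notin> D" if "D \<in> Q" "D \<noteq> C" for D
          using D(2)[OF that(1) C(1) that(2)] C(2) by (simp only: disjoint_iff) blast
        have U: "\<Union>(Q - {C}) = A - C"
        proof -
          have "D \<inter> C = {}" if "D \<in> Q - {C}" for D using D(2)[of D C] that C(1) by simp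
          then have "\<Union>(Q - {C}) \<inter> C = {}" by blast
          moreover have "\<Union>(Q - {C}) \<union> C = insert x A"
            unfolding D(1)[symmetric] using C(1) by blast
          moreover have "V = A - C" if "V \<inter> C = {}" "V \<union> C = insert x A" for V
            using that C(2) insert.hyps(2) by auto
          ultimately show ?thesis by simp
        qed
        have CA: "C - {x} \<subseteq> A" using Union_upper[OF C(1)] unfolding D(1) by blast
        show "Q \<in> ?R"
        proof (cases "C = {x}")
          case True
          have "partition_on A (Q - {C})"
            using D(2,3) U True insert.hyps(2) unfolding partition_on_def disjoint_def by auto
          moreover have "card (Q - {C}) = k" using Q(2) C finQ[OF Q(1)] by simp
          ultimately have "Q - {C} \<in> parts k" by (simp add: parts_def)
          moreover have "Q = f (Q - {C})" using C True by (auto simp: f_def)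
          ultimately show ?thesis by blast
        next
          case False
          define B where "B = C - {x}"
          define P where "P = insert B (Q - {C})"
          have B: "B \<noteq> {}" "insert x B = C" using False C by (auto simp: B_def)
          have nB: "B \<notin> Q - {C}"
          proof
            assume "B \<in> Q - {C}"
            then have "B \<inter> C = {}" using D(2)[of B C] C by blast
            then show False using B by blast
          qed
          have "partition_on A P"
          proof (rule partition_onI)
            show "\<Union>P = A" using U CA insert.hyps(2) C(2) unfolding P_def B_def Union_insert by blast
            show "{} \<notin> P" using D(3) B by (auto simp: P_def)
            have Bq: "disjnt B q" if "q \<in> Q - {C}" for q
              using D(2)[of q C] that C(1) by (auto simp: B_def disjnt_def)
            fix p q assume pq: "p \<in> P" "q \<in> P" "p \<noteq> q"
            then consider "p = B" "q \<in> Q - {C}" | "p \<in> Q - {C}" "q = B"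
              | "p \<in> Q - {C}" "q \<in> Q - {C}" unfolding P_def by blast
            then show "disjnt p q"
            proof cases
              case 3
              then show ?thesis using D(2)[of p q] pq(3) by (simp add: disjnt_def)
            qed (use Bq disjnt_sym in blast)+
          qed
          moreover have "card P = Suc k"
            using nB Q(2) C finQ[OF Q(1)] by (simp add: P_def)
          ultimately have "P \<in> parts (Suc k)" by (simp add: parts_def)
          moreover have "B \<in> P" by (simp add: P_def)
          moreover have "Q = g (P, B)" using nB B C by (auto simp: g_def P_def)
          ultimately show ?thesis by blast
        qed
      qed
    qed
    have dis: "f ` parts k \<inter> g ` (SIGMA P:parts (Suc k). P) = {}"
      using f_in(3) g_in by force
    have "inj_on f (parts k)" by (rule inj_onI) (metis f_in(4))
    then have cf: "card (f ` parts k) = Stirling (card A) k"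
      using insert.IH by (simp add: card_image parts_def)
    have "inj_on g (SIGMA P:parts (Suc k). P)"
    proof (rule inj_onI, clarify)
      fix P B P' B'
      assume h: "P \<in> parts (Suc k)" "B \<in> P" "P' \<in> parts (Suc k)" "B' \<in> P'" "g (P, B) = g (P', B')"
      have "P = P'" using g_in[OF h(1,2)] g_in[OF h(3,4)] h(5) by metis
      moreover have "insert x B = insert x B'" using g_in[OF h(1,2)] g_in[OF h(3,4)] h(5) by auto
      moreover have "x \<notin> B" "x \<notin> B'" using h notx by (auto simp: parts_def)
      ultimately show "P = P' \<and> B = B'" by (metis insert_ident)
    qed
    then have "card (g ` (SIGMA P:parts (Suc k). P)) = (\<Sum>P\<in>parts (Suc k). card P)"
      using fparts finP by (simp add: card_image card_SigmaI parts_def)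
    also have "\<dots> = Suc k * Stirling (card A) (Suc k)"
      using insert.IH[of "Suc k"] by (simp add: parts_def)
    finally have cg: "card (g ` (SIGMA P:parts (Suc k). P)) = Suc k * Stirling (card A) (Suc k)" .
    have "finite (SIGMA P:parts (Suc k). P)"
      using fparts finP by (auto simp: parts_def intro!: finite_SigmaI)
    then show ?thesis
      unfolding eq using fparts insert.hyps dis cf cg Suc by (simp add: card_Un_disjoint)
  qed
qed

end

theory Submission
  imports Defs
begin

text \<open>Two fuzzy sets are equivalent iff their values compare in the same way with each other and
  with \<open>a 0, \<dots>, a (Suc k)\<close>. If \<open>\<mu>\<close> has \<open>l\<close> distinct values strictly between 0 and 1, replace
  every value by its rank in the union of all values with \<open>{a 0, \<dots>, a (Suc k)}\<close>, which has
  \<open>k + l + 2\<close> elements. The classes thereby correspond to the pairs of a number \<open>l\<close> and a map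
  \<open>f : X \<rightarrow> {0, \<dots>, k + l + 1}\<close> taking exactly \<open>l\<close> values in \<open>{1, \<dots>, k + l}\<close>: the ranks missed
  by \<open>f\<close> there are those of the \<open>k\<close> spikes. For fixed \<open>l\<close>, counting these maps by the number
  \<open>i\<close> of points not sent to the two end values gives
  \<open>\<Sum>i. (n choose i) 2^(n - i) l! S(i,l) (k + l choose l)\<close>; the count is verified by adding one
  point of \<open>X\<close> at a time.\<close>

section \<open>Counting maps by the number of values in a given subset\<close>

lemma Stirling_Suc:
  "Stirling (Suc n) l = l * Stirling n l + (if l = 0 then 0 else Stirling n (l - 1))"
  by (cases l) (cases n; simp)+

text \<open>Pascal's rule: a new element either stays outside the chosen \<open>i\<close>-subset and
  contributes a factor \<open>c\<close>, or joins it and shifts \<open>g\<close> by one.\<close>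

lemma sum_binomial_power_Suc:
  fixes g :: "nat \<Rightarrow> 'b::comm_semiring_1"
  shows "(\<Sum>i\<le>Suc n. of_nat (Suc n choose i) * c ^ (Suc n - i) * g i) =
    c * (\<Sum>i\<le>n. of_nat (n choose i) * c ^ (n - i) * g i) +
    (\<Sum>i\<le>n. of_nat (n choose i) * c ^ (n - i) * g (Suc i))"
proof -
  have "(\<Sum>i\<le>Suc n. of_nat (Suc n choose i) * c ^ (Suc n - i) * g i) =
      c ^ Suc n * g 0 + (\<Sum>i\<le>n. of_nat (n choose Suc i) * c ^ (n - i) * g (Suc i)) +
      (\<Sum>i\<le>n. of_nat (n choose i) * c ^ (n - i) * g (Suc i))"
    by (subst sum.atMost_Suc_shift) (simp add: sum.distrib algebra_simps)
  also have "c ^ Suc n * g 0 + (\<Sum>i\<le>n. of_nat (n choose Suc i) * c ^ (n - i) * g (Suc i)) =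
      (\<Sum>i\<le>Suc n. of_nat (n choose i) * c ^ (Suc n - i) * g i)"
    by (subst sum.atMost_Suc_shift) simp
  also have "\<dots> = c * (\<Sum>i\<le>n. of_nat (n choose i) * c ^ (n - i) * g i)"
    by (simp add: sum_distrib_left Suc_diff_le mult_ac binomial_eq_0)
  finally show ?thesis .
qed

text \<open>\<open>fact j * (m choose j)\<close> is a falling factorial whose next factor is
  \<open>m - j\<close>; once \<open>m \<le> j\<close>, truncated subtraction makes both sides
  0.\<close>

lemma fact_times_binomial_Suc: "fact (Suc j) * (m choose Suc j) = (m - j) * (fact j * (m choose j))"
proof -
  have "Suc j * (m choose Suc j) = (m - j) * (m choose j)"
    by (metis Suc_times_binomial_eq binomial_absorb_comp binomial_absorption mult.commute diff_Suc_1)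
  then have "fact j * (Suc j * (m choose Suc j)) = fact j * ((m - j) * (m choose j))"
    by (rule arg_cong)
  then show ?thesis by (simp only: fact_Suc of_nat_id mult_ac)
qed

text \<open>\<open>V\<close> stands for the values taken so far and \<open>y\<close> for the value
  at a new point. The number of values in \<open>B\<close> is unchanged if \<open>y\<close> lies
  outside \<open>B\<close> or in \<open>V \<inter> B\<close>, and grows by one if \<open>y\<close>
  lies in \<open>B - V\<close>.\<close>

lemma card_insert_extensions:
  assumes "finite D" "B \<subseteq> D" "finite V" "V \<subseteq> D"
  shows "card {y \<in> D. card (insert y V \<inter> B) = l} =
    (if card (V \<inter> B) = l then card (D - B) + l else 0) +
    (if Suc (card (V \<inter> B)) = l then card B - card (V \<inter> B) else 0)"
proof -
  have *: "card (insert y V \<inter> B) = (if y \<in> B - V then Suc (card (V \<inter> B)) else card (V \<inter> B))" for y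
    using assms(3) by (simp add: Int_insert_left insert_absorb)
  have fB: "finite B" using assms finite_subset by blast
  consider "card (V \<inter> B) = l" | "Suc (card (V \<inter> B)) = l" | "card (V \<inter> B) \<noteq> l" "Suc (card (V \<inter> B)) \<noteq> l"
    by blast
  then show ?thesis
  proof cases
    case 1
    then have "{y \<in> D. card (insert y V \<inter> B) = l} = (D - B) \<union> (V \<inter> B)"
      using assms by (auto simp: *)
    moreover have "card ((D - B) \<union> (V \<inter> B)) = card (D - B) + card (V \<inter> B)"
      using assms by (intro card_Un_disjoint) auto
    ultimately show ?thesis using 1 by simp
  next
    case 2
    then have "{y \<in> D. card (insert y V \<inter> B) = l} = B - (V \<inter> B)"
      using assms by (auto simp: *)
    moreover have "card (B - (V \<inter> B)) = card B - card (V \<inter> B)"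
      using fB by (intro card_Diff_subset) auto
    ultimately show ?thesis using 2 by simp
  next
    case 3
    then have "{y \<in> D. card (insert y V \<inter> B) = l} = {}"
      unfolding * by auto
    with 3 show ?thesis by (simp only: card.empty if_False)
  qed
qed

text \<open>On the right, choose the \<open>l\<close> values in \<open>B\<close>, the
  \<open>i\<close> points sent onto them, and values outside \<open>B\<close> for the other points.
  The induction shows that both sides obey the same recursion in \<open>card X\<close>, which rests
  on the recurrence of \<open>Stirling\<close>.\<close>

lemma card_PiE_image_Int:
  assumes "finite X" "finite D" "B \<subseteq> D"
  shows "card {f \<in> X \<rightarrow>\<^sub>E D. card (f ` X \<inter> B) = l} =
    fact l * (card B choose l) *
    (\<Sum>i\<le>card X. (card X choose i) * card (D - B) ^ (card X - i) * Stirling i l)"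
  using assms(1)
proof (induction X arbitrary: l rule: finite_induct)
  case empty
  show ?case by (cases l) auto
next
  case (insert x X)
  define m c n where "m = card B" and "c = card (D - B)" and "n = card X"
  define U where "U l = {f \<in> X \<rightarrow>\<^sub>E D. card (f ` X \<inter> B) = l}" for l
  define R where "R l = (\<Sum>i\<le>n. (n choose i) * c ^ (n - i) * Stirling i l)" for l
  have fin: "finite (X \<rightarrow>\<^sub>E D)" using insert assms by (simp add: finite_PiE)
  have IH: "card (U l) = fact l * (m choose l) * R l" for l
    using insert.IH[of l] by (simp add: U_def R_def m_def c_def n_def)
  define E where "E g = {y \<in> D. card (insert y (g ` X) \<inter> B) = l}" for g
  have im: "(g(x := y)) ` insert x X = insert y (g ` X)" for g y
    using insert.hyps by auto
  have "{f \<in> insert x X \<rightarrow>\<^sub>E D. card (f ` insert x X \<inter> B) = l} =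
      (\<lambda>(g, y). g(x := y)) ` (SIGMA g:X \<rightarrow>\<^sub>E D. E g)" (is "?L = ?h ` ?S")
  proof -
    have "?h ` ?S = {f \<in> (\<lambda>(y, g). g(x := y)) ` (D \<times> (X \<rightarrow>\<^sub>E D)). card (f ` insert x X \<inter> B) = l}"
      by (force simp only: E_def im image_iff mem_Sigma_iff mem_Collect_eq prod.case)
    then show ?thesis by (simp add: PiE_insert_eq)
  qed
  moreover have "inj_on ?h ?S"
  proof (rule inj_onI, clarify)
    fix g y g' y' assume "g \<in> X \<rightarrow>\<^sub>E D" "g' \<in> X \<rightarrow>\<^sub>E D" "g(x := y) = g'(x := y')"
    then show "g = g' \<and> y = y'"
      using insert.hyps(2) by (metis PiE_E fun_upd_same fun_upd_triv fun_upd_upd)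
  qed
  ultimately have "card ?L = (\<Sum>g\<in>X \<rightarrow>\<^sub>E D. card (E g))"
    using fin assms by (simp add: card_image card_SigmaI E_def)
  \<comment> \<open>The guard \<open>l \<noteq> 0\<close> is essential, since truncated subtraction
    would make 0 its own predecessor.\<close>
  also have "\<dots> = (\<Sum>g\<in>X \<rightarrow>\<^sub>E D. (if g \<in> U l then c + l else 0) +
      (if l \<noteq> 0 \<and> g \<in> U (l - 1) then m - (l - 1) else 0))"
  proof (rule sum.cong[OF refl])
    fix g assume g: "g \<in> X \<rightarrow>\<^sub>E D"
    have gX: "g ` X \<subseteq> D" using g by auto
    show "card (E g) = (if g \<in> U l then c + l else 0) +
      (if l \<noteq> 0 \<and> g \<in> U (l - 1) then m - (l - 1) else 0)"
      using card_insert_extensions[OF assms(2,3) finite_imageI[OF insert.hyps(1)] gX, of l] g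
      unfolding E_def U_def m_def c_def by (cases l) (simp_all only: mem_Collect_eq, simp_all)
  qed
  also have "\<dots> = card (U l) * (c + l) + (if l = 0 then 0 else card (U (l - 1)) * (m - (l - 1)))"
  proof -
    have "U j = (X \<rightarrow>\<^sub>E D) \<inter> {g. g \<in> U j}" for j unfolding U_def by auto
    then have "(\<Sum>g\<in>X \<rightarrow>\<^sub>E D. if g \<in> U j then d else 0) = card (U j) * d" for j d
      using fin by (simp add: sum.If_cases flip: Int_def)
    then show ?thesis by (cases "l = 0") (simp_all add: sum.distrib)
  qed
  also have "\<dots> = fact l * (m choose l) * ((c + l) * R l + (if l = 0 then 0 else R (l - 1)))"
  proof (cases l)
    case (Suc j)
    show ?thesis unfolding IH Suc
      using fact_times_binomial_Suc[of j m] by (simp add: algebra_simps del: fact_Suc)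
  qed (simp add: IH)
  also have "(c + l) * R l + (if l = 0 then 0 else R (l - 1)) =
      (\<Sum>i\<le>Suc n. (Suc n choose i) * c ^ (Suc n - i) * Stirling i l)"
    using sum_binomial_power_Suc[of n c "\<lambda>i. Stirling i l"]
    by (simp add: Stirling_Suc R_def sum.distrib sum_distrib_left algebra_simps)
  finally show ?case using insert.hyps by (simp add: m_def c_def n_def)
qed

section \<open>Ranks, counted from 0, in finite linear orders\<close>

definition rank_in :: "'b::linorder set \<Rightarrow> 'b \<Rightarrow> nat" where
  "rank_in W t = card {w \<in> W. w < t}"

lemma rank_in_strict_mono_on: "finite W \<Longrightarrow> strict_mono_on W (rank_in W)"
  unfolding rank_in_def by (intro strict_mono_onI psubset_card_mono) auto

lemma rank_in_less_iff:
  assumes "finite W" "s \<in> W" "t \<in> W"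
  shows "rank_in W s < rank_in W t \<longleftrightarrow> s < t"
  using strict_mono_on_less[OF rank_in_strict_mono_on] assms by blast

lemma rank_in_less_card: "finite W \<Longrightarrow> t \<in> W \<Longrightarrow> rank_in W t < card W"
  unfolding rank_in_def by (rule psubset_card_mono) auto

lemma rank_in_image:
  assumes "strict_mono_on A f" "t \<in> A"
  shows "rank_in (f ` A) (f t) = rank_in A t"
proof -
  have "{w \<in> f ` A. w < f t} = f ` {s \<in> A. s < t}"
    using strict_mono_on_less[OF assms(1) _ assms(2)] by auto
  moreover have "inj_on f {s \<in> A. s < t}"
    using strict_mono_on_imp_inj_on[OF assms(1)] by (rule inj_on_subset) auto
  ultimately show ?thesis by (simp add: rank_in_def card_image)
qed

text \<open>Sending \<open>u s\<close> to \<open>v s\<close> is a well-defined bijection between the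
  images; \<open>inv_into K u\<close> picks the representative \<open>s\<close>.\<close>

lemma card_image_cong_eq:
  assumes "\<And>s t. s \<in> K \<Longrightarrow> t \<in> K \<Longrightarrow> u s = u t \<longleftrightarrow> v s = v t"
  shows "card (u ` K) = card (v ` K)"
proof -
  have "inj_on (v \<circ> inv_into K u) (u ` K)"
    by (rule inj_onI) (metis assms comp_apply f_inv_into_f inv_into_into)
  moreover have "(v \<circ> inv_into K u) ` u ` K = v ` K"
    unfolding image_image comp_def
    by (rule image_cong[OF refl]) (metis assms f_inv_into_f imageI inv_into_into)
  ultimately show ?thesis by (metis card_image)
qed

text \<open>A rank counts distinct values rather than indices, so equalities must be transferred
  too; by linearity they follow from the strict comparisons.\<close>

lemma rank_in_image_cong:
  fixes u :: "'c \<Rightarrow> 'b::linorder" and v :: "'c \<Rightarrow> 'd::linorder"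
  assumes "\<And>s t. s \<in> J \<Longrightarrow> t \<in> J \<Longrightarrow> u s < u t \<longleftrightarrow> v s < v t" and "t \<in> J"
  shows "rank_in (u ` J) (u t) = rank_in (v ` J) (v t)"
proof -
  have "{w \<in> u ` J. w < u t} = u ` {s \<in> J. u s < u t}" "{w \<in> v ` J. w < v t} = v ` {s \<in> J. v s < v t}"
    by auto
  moreover have "{s \<in> J. u s < u t} = {s \<in> J. v s < v t}" using assms by blast
  moreover have "card (u ` {s \<in> J. v s < v t}) = card (v ` {s \<in> J. v s < v t})"
    by (rule card_image_cong_eq) (metis (mono_tags, lifting) assms(1) mem_Collect_eq linorder_neq_iff)
  ultimately show ?thesis by (simp add: rank_in_def)
qed

section \<open>Coding a fuzzy set by ranks\<close>

definition grid :: "nat \<Rightarrow> (nat \<Rightarrow> real) \<Rightarrow> 'a set \<Rightarrow> ('a \<Rightarrow> real) \<Rightarrow> real set" where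
  "grid k a X \<mu> = a ` {0..Suc k} \<union> \<mu> ` X"

text \<open>The ranks alone do not determine the number \<open>l\<close> of inner values, those
  strictly between 0 and 1: for two points, ranks 1 and \<open>k + 2\<close> arise with
  \<open>l = 1\<close>, the second value being 1, and with \<open>l = 2\<close>, both values being
  inner.\<close>

definition code :: "nat \<Rightarrow> (nat \<Rightarrow> real) \<Rightarrow> 'a set \<Rightarrow> ('a \<Rightarrow> real) \<Rightarrow> nat \<times> ('a \<Rightarrow> nat)" where
  "code k a X \<mu> = (card (\<mu> ` X \<inter> {0<..<1}), \<lambda>x\<in>X. rank_in (grid k a X \<mu>) (\<mu> x))"

text \<open>Bounding \<open>l\<close> by \<open>card X\<close> keeps the index set finite, so that
  the cardinality becomes a finite sum over \<open>l\<close>.\<close>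

definition codes :: "nat \<Rightarrow> 'a set \<Rightarrow> (nat \<times> ('a \<Rightarrow> nat)) set" where
  "codes k X = (SIGMA l:{..card X}. {f \<in> X \<rightarrow>\<^sub>E {0..Suc (k + l)}. card (f ` X \<inter> {1..k + l}) = l})"

section \<open>Equivalence as agreement of strict comparisons\<close>

context
  fixes k :: nat and a :: "nat \<Rightarrow> real" and X :: "'a set"
  assumes sp: "spikes k a" and finX: "finite X"
begin

lemma spike_less_iff: "i \<le> Suc k \<Longrightarrow> j \<le> Suc k \<Longrightarrow> a i < a j \<longleftrightarrow> i < j"
  using sp strict_mono_on_less[of "{0..Suc k}" a i j] by (auto simp: spikes_def)

lemma spike_eq_iff: "i \<le> Suc k \<Longrightarrow> j \<le> Suc k \<Longrightarrow> a i = a j \<longleftrightarrow> i = j"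
  by (metis spike_less_iff linorder_neq_iff)

lemma spike_0 [simp]: "a 0 = 0" and spike_last [simp]: "a (Suc k) = 1"
  using sp by (auto simp: spikes_def)

lemma spike_inner: "1 \<le> i \<Longrightarrow> i \<le> k \<Longrightarrow> 0 < a i \<and> a i < 1"
  using spike_less_iff[of 0 i] spike_less_iff[of i "Suc k"] by simp

lemma fuzzy_setsD:
  assumes "\<mu> \<in> fuzzy_sets k a X" "x \<in> X"
  shows "0 \<le> \<mu> x" "\<mu> x \<le> 1" "\<And>i. 1 \<le> i \<Longrightarrow> i \<le> k \<Longrightarrow> \<mu> x \<noteq> a i"
  using assms by (auto simp: fuzzy_sets_def dest!: PiE_mem)

text \<open>For an inner value take the largest \<open>i \<le> k\<close> with
  \<open>a i < \<mu> x\<close>. Reaching \<open>a (Suc i)\<close> would contradict maximality,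
  because spikes are avoided, or the bound 1 if \<open>i = k\<close>.\<close>

lemma fuzzy_value_cases:
  assumes "\<mu> \<in> fuzzy_sets k a X" "x \<in> X"
  obtains "\<mu> x = 0" | "\<mu> x = 1" | i where "i \<le> k" "a i < \<mu> x" "\<mu> x < a (Suc i)"
proof -
  note D = fuzzy_setsD[OF assms]
  show ?thesis
  proof (cases "\<mu> x = 0 \<or> \<mu> x = 1")
    case False
    define i where "i = Max {i. i \<le> k \<and> a i < \<mu> x}"
    have fin: "finite {i. i \<le> k \<and> a i < \<mu> x}" by simp
    have "0 \<in> {i. i \<le> k \<and> a i < \<mu> x}" using False D by simp
    then have i: "i \<in> {i. i \<le> k \<and> a i < \<mu> x}" unfolding i_def using Max_in[OF fin] by blast
    have "\<mu> x < a (Suc i)"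
    proof (rule ccontr)
      assume *: "\<not> \<mu> x < a (Suc i)"
      then have "i < k" using i False D by (cases "i = k") auto
      then have "Suc i \<in> {i. i \<le> k \<and> a i < \<mu> x}" using * D(3)[of "Suc i"] by auto
      then show False using Max_ge[OF fin, of "Suc i"] unfolding i_def[symmetric] by simp
    qed
    then show ?thesis using i that by blast
  qed (use that in blast)
qed

definition same_order :: "('a \<Rightarrow> real) \<Rightarrow> ('a \<Rightarrow> real) \<Rightarrow> bool" where
  "same_order \<mu> \<nu> \<longleftrightarrow>
     (\<forall>i\<le>Suc k. \<forall>x\<in>X. (a i < \<mu> x \<longleftrightarrow> a i < \<nu> x) \<and> (\<mu> x < a i \<longleftrightarrow> \<nu> x < a i)) \<and>
     (\<forall>x\<in>X. \<forall>y\<in>X. \<mu> x < \<mu> y \<longleftrightarrow> \<nu> x < \<nu> y)"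

lemma fuzzy_equivD:
  assumes "fuzzy_equiv k a X \<mu> \<nu>" "x \<in> X"
  shows "\<mu> x = 0 \<longleftrightarrow> \<nu> x = 0" "\<mu> x = 1 \<longleftrightarrow> \<nu> x = 1"
    and "\<And>y i. y \<in> X \<Longrightarrow> i \<le> k \<Longrightarrow>
      (\<mu> x < a (Suc i) \<and> \<mu> y \<le> \<mu> x \<and> a i < \<mu> y) \<longleftrightarrow>
      (\<nu> x < a (Suc i) \<and> \<nu> y \<le> \<nu> x \<and> a i < \<nu> y)"
  using assms unfolding fuzzy_equiv_def by (auto simp: Ball_def)

lemma fuzzy_equiv_sym: "fuzzy_equiv k a X \<mu> \<nu> \<Longrightarrow> fuzzy_equiv k a X \<nu> \<mu>"
  unfolding fuzzy_equiv_def by simp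

text \<open>Clause (ii) with \<open>y = x\<close> puts \<open>\<nu> x\<close> into the same gap
  between consecutive spikes as \<open>\<mu> x\<close>, and no \<open>a j\<close> lies inside a
  gap.\<close>

lemma fuzzy_equiv_spike_less:
  assumes "\<mu> \<in> fuzzy_sets k a X" "fuzzy_equiv k a X \<mu> \<nu>" "x \<in> X" "j \<le> Suc k"
  shows "a j < \<mu> x \<longleftrightarrow> a j < \<nu> x" and "\<mu> x < a j \<longleftrightarrow> \<nu> x < a j"
proof -
  note E = fuzzy_equivD[OF assms(2,3)]
  have "(a j < \<mu> x \<longleftrightarrow> a j < \<nu> x) \<and> (\<mu> x < a j \<longleftrightarrow> \<nu> x < a j)"
    using assms(1,3)
  proof (cases rule: fuzzy_value_cases)
    case 1
    then show ?thesis using E(1) by simp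
  next
    case 2
    then show ?thesis using E(2) by simp
  next
    case (3 i)
    then have "a i < \<nu> x" "\<nu> x < a (Suc i)" using E(3)[OF assms(3), of i] by auto
    moreover have "j \<le> i \<or> Suc i \<le> j" by auto
    then have "a j \<le> a i \<or> a (Suc i) \<le> a j"
      using spike_less_iff[of i j] spike_less_iff[of j "Suc i"] 3(1) assms(4)
      by (auto simp: not_less[symmetric])
    ultimately show ?thesis using 3 by auto
  qed
  then show "a j < \<mu> x \<longleftrightarrow> a j < \<nu> x" "\<mu> x < a j \<longleftrightarrow> \<nu> x < a j" by auto
qed

text \<open>If both values lie in one gap, clause (ii) for \<open>(x, y)\<close> and for
  \<open>(y, x)\<close> decides the order; otherwise some \<open>a i\<close> or the end value 0 or 1
  separates them.\<close>

lemma fuzzy_equiv_less: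
  assumes "\<mu> \<in> fuzzy_sets k a X" "fuzzy_equiv k a X \<mu> \<nu>" "x \<in> X" "y \<in> X" "\<mu> x < \<mu> y"
  shows "\<nu> x < \<nu> y"
  using assms(1,4)
proof (cases rule: fuzzy_value_cases)
  case 1
  then show ?thesis using fuzzy_setsD(1)[OF assms(1,3)] assms(5) by simp
next
  case 2
  then show ?thesis
    using fuzzy_equivD(2)[OF assms(2,4)] fuzzy_equiv_spike_less(2)[OF assms(1,2,3), of "Suc k"] assms(5)
    by simp
next
  case (3 i)
  show ?thesis
  proof (cases "\<mu> x \<le> a i")
    case True
    then show ?thesis
      using fuzzy_equiv_spike_less(1)[OF assms(1,2,3), of i] fuzzy_equiv_spike_less(1)[OF assms(1,2,4), of i] 3
      by simp
  next
    case False
    then show ?thesis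
      using fuzzy_equivD(3)[OF assms(2,3,4), of i] fuzzy_equivD(3)[OF assms(2,4,3), of i] 3 assms(5)
      by linarith
  qed
qed

lemma same_orderI_fuzzy_equiv:
  assumes "\<mu> \<in> fuzzy_sets k a X" "\<nu> \<in> fuzzy_sets k a X" "fuzzy_equiv k a X \<mu> \<nu>"
  shows "same_order \<mu> \<nu>"
  using fuzzy_equiv_spike_less[OF assms(1,3)] fuzzy_equiv_less[OF assms(1,3)]
    fuzzy_equiv_less[OF assms(2) fuzzy_equiv_sym[OF assms(3)]]
  unfolding same_order_def by blast

lemma fuzzy_equivI_same_order:
  assumes "same_order \<mu> \<nu>"
  shows "fuzzy_equiv k a X \<mu> \<nu>"
proof -
  have A: "a j < \<mu> x \<longleftrightarrow> a j < \<nu> x" "\<mu> x < a j \<longleftrightarrow> \<nu> x < a j" if "x \<in> X" "j \<le> Suc k" for x j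
    using assms that by (auto simp: same_order_def)
  have B: "\<mu> x \<le> \<mu> y \<longleftrightarrow> \<nu> x \<le> \<nu> y" if "x \<in> X" "y \<in> X" for x y
    using assms that by (auto simp: same_order_def not_less[symmetric])
  have C: "\<mu> x = a j \<longleftrightarrow> \<nu> x = a j" if "x \<in> X" "j \<le> Suc k" for x j
    using A[OF that] by (metis linorder_neq_iff)
  show ?thesis unfolding fuzzy_equiv_def
    by (intro ballI) (simp add: A B C del: spike_0 spike_last)
qed

section \<open>Ranks within the grid of a fuzzy set\<close>

lemma finite_grid: "finite (grid k a X \<mu>)"
  using finX by (simp add: grid_def)

lemma value_in_grid: "x \<in> X \<Longrightarrow> \<mu> x \<in> grid k a X \<mu>"
  by (simp add: grid_def)

lemma spike_in_grid: "i \<le> Suc k \<Longrightarrow> a i \<in> grid k a X \<mu>"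
  by (simp add: grid_def)

text \<open>Boundary values are already \<open>a 0\<close> or \<open>a (Suc k)\<close>, and inner
  values avoid the spikes; the disjointness is what makes cardinalities add.\<close>

lemma grid_eq:
  assumes "\<mu> \<in> fuzzy_sets k a X"
  shows "grid k a X \<mu> = a ` {0..Suc k} \<union> (\<mu> ` X \<inter> {0<..<1})"
    and "a ` {0..Suc k} \<inter> (\<mu> ` X \<inter> {0<..<1}) = {}"
proof -
  have "\<mu> x \<in> a ` {0..Suc k} \<longleftrightarrow> \<mu> x \<notin> {0<..<1}" if "x \<in> X" for x
  proof
    assume "\<mu> x \<in> a ` {0..Suc k}"
    then obtain i where "i \<le> Suc k" "\<mu> x = a i" by auto
    then show "\<mu> x \<notin> {0<..<1}"
      using fuzzy_setsD(3)[OF assms that, of i] by (cases "i = 0"; cases "i = Suc k") auto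
  next
    assume "\<mu> x \<notin> {0<..<1}"
    then have "\<mu> x = a 0 \<or> \<mu> x = a (Suc k)" using fuzzy_setsD(1,2)[OF assms that] by auto
    then show "\<mu> x \<in> a ` {0..Suc k}" by fastforce
  qed
  then have "w \<in> a ` {0..Suc k} \<longleftrightarrow> w \<notin> {0<..<1}" if "w \<in> \<mu> ` X" for w
    using that by (metis imageE)
  then show "grid k a X \<mu> = a ` {0..Suc k} \<union> (\<mu> ` X \<inter> {0<..<1})"
    "a ` {0..Suc k} \<inter> (\<mu> ` X \<inter> {0<..<1}) = {}"
    unfolding grid_def by blast+
qed

lemma card_grid:
  assumes "\<mu> \<in> fuzzy_sets k a X"
  shows "card (grid k a X \<mu>) = k + 2 + card (\<mu> ` X \<inter> {0<..<1})"
proof -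
  have "inj_on a {0..Suc k}" by (rule inj_onI) (simp add: spike_eq_iff)
  then show ?thesis unfolding grid_eq(1)[OF assms]
    using grid_eq(2)[OF assms] finX by (subst card_Un_disjoint) (auto simp: card_image)
qed

lemma grid_bounds:
  assumes "\<mu> \<in> fuzzy_sets k a X" "w \<in> grid k a X \<mu>"
  shows "0 \<le> w \<and> w \<le> 1"
proof -
  have "0 \<le> a i \<and> a i \<le> 1" if "i \<le> Suc k" for i
    using spike_inner[of i] that by (cases "i = 0"; cases "i = Suc k") auto
  then show ?thesis using assms fuzzy_setsD(1,2)[OF assms(1)] by (auto simp: grid_def)
qed

lemma rank_in_grid_0:
  assumes "\<mu> \<in> fuzzy_sets k a X"
  shows "rank_in (grid k a X \<mu>) 0 = 0"
proof -
  have "{w \<in> grid k a X \<mu>. w < 0} = {}" using grid_bounds[OF assms] by force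
  then show ?thesis unfolding rank_in_def by (simp only: card.empty)
qed

lemma rank_in_grid_1:
  assumes "\<mu> \<in> fuzzy_sets k a X"
  shows "rank_in (grid k a X \<mu>) 1 = Suc (k + card (\<mu> ` X \<inter> {0<..<1}))"
proof -
  have "{w \<in> grid k a X \<mu>. w < 1} = grid k a X \<mu> - {1}" using grid_bounds[OF assms] by force
  moreover have "1 \<in> grid k a X \<mu>" using spike_in_grid[of "Suc k"] by simp
  ultimately show ?thesis unfolding rank_in_def
    using card_grid[OF assms] by (simp only: card_Diff_singleton)
qed

text \<open>The values 0 and 1 have the extreme ranks 0 and \<open>k + l + 1\<close>, with
  \<open>l\<close> the number of inner values. Hence a rank together with \<open>l\<close> reveals
  whether a value is inner.\<close>

lemma rank_in_grid_inner_iff: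
  assumes \<mu>: "\<mu> \<in> fuzzy_sets k a X" and w: "w \<in> grid k a X \<mu>"
  shows "0 < rank_in (grid k a X \<mu>) w \<longleftrightarrow> 0 < w"
    and "rank_in (grid k a X \<mu>) w \<le> k + card (\<mu> ` X \<inter> {0<..<1}) \<longleftrightarrow> w < 1"
  using rank_in_less_iff[OF finite_grid _ w, of 0] spike_in_grid[of 0 \<mu>] rank_in_grid_0[OF \<mu>]
    rank_in_less_iff[OF finite_grid w, of 1] spike_in_grid[of "Suc k" \<mu>] rank_in_grid_1[OF \<mu>]
  by (simp_all add: less_Suc_eq_le)

lemma code_in_codes:
  assumes \<mu>: "\<mu> \<in> fuzzy_sets k a X"
  shows "code k a X \<mu> \<in> codes k X"
proof -
  define l where "l = card (\<mu> ` X \<inter> {0<..<1})"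
  define \<rho> where "\<rho> = rank_in (grid k a X \<mu>)"
  have "l \<le> card (\<mu> ` X)" unfolding l_def using finX by (intro card_mono) auto
  then have "l \<le> card X" using card_image_le[OF finX, of \<mu>] by linarith
  moreover have "\<rho> (\<mu> x) \<le> Suc (k + l)" if "x \<in> X" for x
    using rank_in_less_card[OF finite_grid value_in_grid[OF that], of \<mu>] card_grid[OF \<mu>]
    by (simp add: \<rho>_def l_def)
  moreover have "card ((\<lambda>x\<in>X. \<rho> (\<mu> x)) ` X \<inter> {1..k + l}) = l"
  proof -
    have "\<rho> (\<mu> x) \<in> {1..k + l} \<longleftrightarrow> \<mu> x \<in> {0<..<1}" if "x \<in> X" for x
      using rank_in_grid_inner_iff[OF \<mu> value_in_grid[OF that]] by (auto simp: \<rho>_def l_def)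
    then have "(\<lambda>x\<in>X. \<rho> (\<mu> x)) ` X \<inter> {1..k + l} = \<rho> ` (\<mu> ` X \<inter> {0<..<1})" by auto
    moreover have "inj_on \<rho> (\<mu> ` X \<inter> {0<..<1})"
      using strict_mono_on_imp_inj_on[OF rank_in_strict_mono_on[OF finite_grid]]
      unfolding \<rho>_def by (rule inj_on_subset) (auto simp: grid_def)
    ultimately show ?thesis by (simp add: card_image l_def)
  qed
  ultimately show ?thesis by (auto simp: code_def codes_def \<rho>_def l_def)
qed

section \<open>Codes are equal exactly for equivalent fuzzy sets\<close>

lemma code_eqI_same_order:
  assumes "same_order \<mu> \<nu>"
  shows "code k a X \<mu> = code k a X \<nu>"
proof -
  have A: "a j < \<mu> x \<longleftrightarrow> a j < \<nu> x" "\<mu> x < a j \<longleftrightarrow> \<nu> x < a j" if "x \<in> X" "j \<le> Suc k" for x j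
    using assms that by (auto simp: same_order_def)
  have B: "\<mu> x < \<mu> y \<longleftrightarrow> \<nu> x < \<nu> y" if "x \<in> X" "y \<in> X" for x y
    using assms that by (auto simp: same_order_def)
  define K where "K = {x \<in> X. 0 < \<nu> x \<and> \<nu> x < 1}"
  have "\<mu> ` X \<inter> {0<..<1} = \<mu> ` K" "\<nu> ` X \<inter> {0<..<1} = \<nu> ` K"
    using A[of _ 0] A[of _ "Suc k"] by (auto simp: K_def)
  moreover have "card (\<mu> ` K) = card (\<nu> ` K)"
    by (rule card_image_cong_eq) (metis (no_types, lifting) B K_def linorder_neq_iff mem_Collect_eq)
  moreover have "rank_in (grid k a X \<mu>) (\<mu> x) = rank_in (grid k a X \<nu>) (\<nu> x)" if "x \<in> X" for x
  proof -
    \<comment> \<open>The disjoint sum of spike indices and points indexes both grids at once, as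
      \<open>rank_in_image_cong\<close> requires.\<close>
    define J where "J = Inl ` {0..Suc k} \<union> Inr ` X"
    have im: "grid k a X \<xi> = case_sum a \<xi> ` J" for \<xi>
      by (simp add: grid_def J_def image_Un image_image)
    have "rank_in (case_sum a \<mu> ` J) (case_sum a \<mu> (Inr x)) = rank_in (case_sum a \<nu> ` J) (case_sum a \<nu> (Inr x))"
      by (rule rank_in_image_cong) (use that in \<open>auto simp: J_def A B\<close>)
    then show ?thesis by (simp add: im)
  qed
  ultimately show ?thesis by (simp add: code_def cong: restrict_cong)
qed

text \<open>The code does not record the ranks of the spikes. They are recovered by counting: the rank of
  \<open>\<mu> x\<close>, minus the number of non-boundary values below \<open>\<mu> x\<close>, is the number of \<open>a i\<close> below \<open>\<mu> x\<close>.\<close>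

lemma same_orderI_code_eq:
  assumes \<mu>: "\<mu> \<in> fuzzy_sets k a X" and \<nu>: "\<nu> \<in> fuzzy_sets k a X"
    and eq: "code k a X \<mu> = code k a X \<nu>"
  shows "same_order \<mu> \<nu>"
proof -
  have l: "card (\<mu> ` X \<inter> {0<..<1}) = card (\<nu> ` X \<inter> {0<..<1})"
    and r: "\<And>x. x \<in> X \<Longrightarrow> rank_in (grid k a X \<mu>) (\<mu> x) = rank_in (grid k a X \<nu>) (\<nu> x)"
    using eq by (auto simp: code_def dest: fun_cong split: if_splits)
  have B: "\<mu> x < \<mu> y \<longleftrightarrow> \<nu> x < \<nu> y" if "x \<in> X" "y \<in> X" for x y
    using rank_in_less_iff[OF finite_grid[of \<mu>] value_in_grid[OF that(1)] value_in_grid[OF that(2)]]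
      rank_in_less_iff[OF finite_grid[of \<nu>] value_in_grid[OF that(1)] value_in_grid[OF that(2)]]
      r that by simp
  have in01: "0 < \<mu> x \<longleftrightarrow> 0 < \<nu> x" "\<mu> x < 1 \<longleftrightarrow> \<nu> x < 1" if "x \<in> X" for x
    using rank_in_grid_inner_iff[OF \<mu> value_in_grid[OF that]]
      rank_in_grid_inner_iff[OF \<nu> value_in_grid[OF that]] l r[OF that] by simp_all
  have split: "rank_in (grid k a X \<xi>) (\<xi> x) = card {i. i \<le> Suc k \<and> a i < \<xi> x} +
      card (\<xi> ` {y \<in> X. 0 < \<xi> y \<and> \<xi> y < 1 \<and> \<xi> y < \<xi> x})" if \<xi>: "\<xi> \<in> fuzzy_sets k a X" for \<xi> x
  proof -
    have "{w \<in> grid k a X \<xi>. w < \<xi> x} = a ` {i. i \<le> Suc k \<and> a i < \<xi> x} \<union>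
        \<xi> ` {y \<in> X. 0 < \<xi> y \<and> \<xi> y < 1 \<and> \<xi> y < \<xi> x}"
      unfolding grid_eq(1)[OF \<xi>] by auto
    moreover have "a ` {i. i \<le> Suc k \<and> a i < \<xi> x} \<inter>
        \<xi> ` {y \<in> X. 0 < \<xi> y \<and> \<xi> y < 1 \<and> \<xi> y < \<xi> x} = {}"
      using grid_eq(2)[OF \<xi>] by fastforce
    moreover have "inj_on a {i. i \<le> Suc k \<and> a i < \<xi> x}" by (rule inj_onI) (simp add: spike_eq_iff)
    ultimately show ?thesis unfolding rank_in_def
      using finX by (simp add: card_Un_disjoint card_image)
  qed
  have A: "a j < \<mu> x \<longleftrightarrow> a j < \<nu> x" if "x \<in> X" "j \<le> Suc k" for x j
  proof -
    define K where "K = {y \<in> X. 0 < \<nu> y \<and> \<nu> y < 1 \<and> \<nu> y < \<nu> x}"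
    have "{y \<in> X. 0 < \<mu> y \<and> \<mu> y < 1 \<and> \<mu> y < \<mu> x} = K"
      using in01 B that(1) by (auto simp: K_def)
    moreover have "card (\<mu> ` K) = card (\<nu> ` K)"
      by (rule card_image_cong_eq) (metis (no_types, lifting) B K_def linorder_neq_iff mem_Collect_eq)
    ultimately have c: "card {i. i \<le> Suc k \<and> a i < \<mu> x} = card {i. i \<le> Suc k \<and> a i < \<nu> x}"
      using split[OF \<mu>, of x] split[OF \<nu>, of x] r[OF that(1)] by (simp add: K_def)
    \<comment> \<open>The sets of indices \<open>i\<close> with \<open>a i < t\<close> are nested as
      \<open>t\<close> varies, so equal cardinalities force them to coincide.\<close>
    have less: "a j < t' " if "card {i. i \<le> Suc k \<and> a i < t} = card {i. i \<le> Suc k \<and> a i < t'}" "a j < t" "j \<le> Suc k"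
      for t t' :: real
    proof (rule ccontr)
      assume n: "\<not> a j < t'"
      have "a i < t" if "i \<le> Suc k" "a i < t'" for i
        using that n \<open>a j < t\<close> by linarith
      then have "{i. i \<le> Suc k \<and> a i < t'} \<subset> {i. i \<le> Suc k \<and> a i < t}"
        using n that by blast
      from psubset_card_mono[OF _ this] show False using that(1) by simp
    qed
    show ?thesis using less[OF c] less[OF c[symmetric]] that(2) by blast
  qed
  \<comment> \<open>Equalities turn \<open>A\<close> into the reverse comparison: spikes with
    \<open>1 \<le> j \<le> k\<close> are never values, and \<open>in01\<close> settles the two
    ends.\<close>
  have E: "\<mu> x = a j \<longleftrightarrow> \<nu> x = a j" if xj: "x \<in> X" "j \<le> Suc k" for x j
  proof -
    note D = fuzzy_setsD[OF \<mu> xj(1)] fuzzy_setsD[OF \<nu> xj(1)]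
    consider "j = 0" | "j = Suc k" | "1 \<le> j" "j \<le> k" using xj(2) by linarith
    then show ?thesis
    proof cases
      case 1
      then show ?thesis using D(1,4) in01(1)[OF xj(1)] by auto
    next
      case 2
      then show ?thesis using D(2,5) in01(2)[OF xj(1)] by auto
    next
      case 3
      then show ?thesis using D(3)[of j] D(6)[of j] by simp
    qed
  qed
  have "\<mu> x < a j \<longleftrightarrow> \<nu> x < a j" if "x \<in> X" "j \<le> Suc k" for x j
    using A[OF that] E[OF that] by (metis linorder_neq_iff order_less_asym)
  with A B show ?thesis by (simp add: same_order_def)
qed

section \<open>Realizing every code\<close>

text \<open>Exactly \<open>k\<close> ranks in \<open>{1..m}\<close> are missed by \<open>f\<close>,
  one for each spike. If a strictly increasing \<open>\<theta>\<close> on \<open>{0..Suc m}\<close>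
  takes them to the spikes and the ends to 0 and 1, the grid of \<open>\<theta> \<circ> f\<close> is
  the whole image of \<open>\<theta>\<close>, so its ranks return \<open>f\<close>.\<close>

lemma code_surj:
  assumes "p \<in> codes k X"
  shows "\<exists>\<mu>\<in>fuzzy_sets k a X. code k a X \<mu> = p"
proof -
  obtain l f where p: "p = (l, f)" by fastforce
  define m where "m = k + l"
  have f: "f \<in> X \<rightarrow>\<^sub>E {0..Suc m}" "card (f ` X \<inter> {1..m}) = l"
    using assms by (auto simp: p codes_def m_def)
  define C where "C = insert (Suc m) ({1..m} - f ` X)"
  have finC: "finite C" and C: "C \<subseteq> {1..Suc m}" "Suc m \<in> C" by (auto simp: C_def)
  have "{1..m} - f ` X = {1..m} - (f ` X \<inter> {1..m})" by auto
  then have cardC: "card C = Suc k"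
    using f(2) by (simp add: C_def card_Diff_subset m_def)
  \<comment> \<open>\<open>j q\<close> is the index of the last spike placed at or below rank
    \<open>q\<close>, with \<open>Suc m\<close> as the place of \<open>a (Suc k)\<close>; it is 0
    before the first element of \<open>C\<close>.\<close>
  define j where "j q = card (C \<inter> {..q})" for q
  have j_mono: "j q \<le> j r" if "q \<le> r" for q r
    unfolding j_def using that finC by (intro card_mono) auto
  have j_strict: "j q < j r" if "q < r" "r \<in> C" for q r
  proof -
    have "r \<in> C \<inter> {..r} - C \<inter> {..q}" "C \<inter> {..q} \<subseteq> C \<inter> {..r}" using that by auto
    then show ?thesis unfolding j_def using finC by (intro psubset_card_mono) auto
  qed
  have j_le: "j q \<le> Suc k" for q
    unfolding j_def cardC[symmetric] using finC by (intro card_mono) auto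
  have j_le': "j q \<le> k" if "q < Suc m" for q
    using j_strict[OF that C(2)] j_le[of "Suc m"] by linarith
  have j_pos: "1 \<le> j q" if "q \<in> C" for q
    using that finC by (auto simp: j_def Suc_le_eq card_gt_0_iff)
  have j0: "j 0 = 0" using C(1) by (auto simp: j_def)
  have j_last: "j (Suc m) = Suc k" using C(1) cardC by (simp add: j_def Int_absorb2 subset_iff)
  txt \<open>\<open>C\<close> holds the ranks that the spikes and the value 1 must receive, so \<open>\<theta>\<close> sends the
    \<open>j\<close>-th element of \<open>C\<close> to \<open>a j\<close> and interpolates in between; this turns the prescribed
    ranks into actual values.\<close>
  define \<theta> where "\<theta> q = (if q \<in> C then a (j q)
    else a (j q) + (a (Suc (j q)) - a (j q)) * (q / Suc (Suc m)))" for q :: nat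
  have \<theta>_ge: "a (j q) \<le> \<theta> q" if "q \<le> Suc m" for q
  proof (cases "q \<in> C")
    case False
    then have "q < Suc m" using C(2) that by (cases "q = Suc m") auto
    then have "a (j q) < a (Suc (j q))" using j_le'[of q] spike_less_iff[of "j q" "Suc (j q)"] by simp
    with False show ?thesis by (simp add: \<theta>_def)
  qed (simp add: \<theta>_def)
  \<comment> \<open>The denominator \<open>m + 2\<close> exceeds every rank, so the interpolation
    stops short of the next spike.\<close>
  have \<theta>_less: "\<theta> q < a (Suc (j q))" if "q < Suc m" for q
  proof -
    have lt: "a (j q) < a (Suc (j q))" using that j_le'[of q] spike_less_iff[of "j q" "Suc (j q)"] by simp
    moreover have "real q / Suc (Suc m) < 1" using that by simp
    ultimately have "(a (Suc (j q)) - a (j q)) * (q / Suc (Suc m)) < (a (Suc (j q)) - a (j q)) * 1"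
      by (intro mult_strict_left_mono) simp_all
    with lt show ?thesis by (simp add: \<theta>_def)
  qed
  have mono: "strict_mono_on {0..Suc m} \<theta>"
  proof (rule strict_mono_onI)
    fix q r assume qr: "q \<in> {0..Suc m}" "r \<in> {0..Suc m}" "q < r"
    show "\<theta> q < \<theta> r"
    proof (cases "j q = j r")
      case True
      have lt: "a (j q) < a (Suc (j q))" using qr j_le'[of q] spike_less_iff[of "j q" "Suc (j q)"] by simp
      have nr: "r \<notin> C" using j_strict[OF qr(3)] True by auto
      have "(a (Suc (j q)) - a (j q)) * (q / Suc (Suc m)) < (a (Suc (j q)) - a (j q)) * (r / Suc (Suc m))"
        using lt qr(3) by (intro mult_strict_left_mono divide_strict_right_mono) simp_all
      \<comment> \<open>This covers \<open>q \<in> C\<close>, where \<open>\<theta> q\<close> is the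
        spike itself without an increment.\<close>
      moreover have "0 \<le> (a (Suc (j q)) - a (j q)) * (q / Suc (Suc m))"
        using lt by simp
      ultimately show ?thesis using True nr by (simp add: \<theta>_def)
    next
      case False
      then have "Suc (j q) \<le> j r" using j_mono[of q r] qr by simp
      then have "a (Suc (j q)) \<le> a (j r)"
        using spike_less_iff[of "j r" "Suc (j q)"] j_le[of r] by (simp add: not_less[symmetric])
      then show ?thesis using \<theta>_less[of q] \<theta>_ge[of r] qr by simp
    qed
  qed
  have inj: "inj_on \<theta> {0..Suc m}" by (rule strict_mono_on_imp_inj_on[OF mono])
  have \<theta>0: "\<theta> 0 = 0" using C(1) j0 by (auto simp: \<theta>_def)
  have \<theta>1: "\<theta> (Suc m) = 1" using C(2) j_last by (simp add: \<theta>_def)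
  \<comment> \<open>Containment suffices, as both sides have \<open>k + 1\<close> elements.\<close>
  have \<theta>C: "\<theta> ` C = a ` {1..Suc k}"
  proof (rule card_subset_eq)
    show "\<theta> ` C \<subseteq> a ` {1..Suc k}" using j_pos j_le by (auto simp: \<theta>_def)
    have "inj_on \<theta> C" using inj by (rule inj_on_subset) (use C in auto)
    moreover have "inj_on a {1..Suc k}" by (rule inj_onI) (simp add: spike_eq_iff)
    ultimately show "card (\<theta> ` C) = card (a ` {1..Suc k})" by (simp add: card_image cardC)
  qed simp
  define \<mu> where "\<mu> = (\<lambda>x\<in>X. \<theta> (f x))"
  have fX: "f x \<le> Suc m" if "x \<in> X" for x using f(1) that by auto
  have inner: "\<theta> q \<in> {0<..<1} \<longleftrightarrow> q \<in> {1..m}" if "q \<le> Suc m" for q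
    using strict_mono_on_less[OF mono, of 0 q] strict_mono_on_less[OF mono, of q "Suc m"] that \<theta>0 \<theta>1
    by auto
  have "\<mu> x \<in> {0..1} - a ` {1..k}" if x: "x \<in> X" for x
  proof -
    have "0 \<le> \<theta> (f x)" "\<theta> (f x) \<le> 1"
      using strict_mono_on_leD[OF mono, of 0 "f x"] strict_mono_on_leD[OF mono, of "f x" "Suc m"]
        fX[OF x] \<theta>0 \<theta>1 by auto
    moreover have "\<theta> (f x) \<notin> a ` {1..k}"
    proof
      assume *: "\<theta> (f x) \<in> a ` {1..k}"
      then have "\<theta> (f x) \<in> {0<..<1}" using spike_inner by auto
      then have "f x \<in> {1..m}" using inner fX[OF x] by blast
      moreover have "\<theta> (f x) \<in> \<theta> ` C" using * by (auto simp: \<theta>C)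
      then have "f x \<in> C" using inj_on_image_mem_iff[OF inj, of "f x" C] fX[OF x] C(1) by fastforce
      ultimately show False using x by (auto simp: C_def)
    qed
    ultimately show ?thesis using x by (simp add: \<mu>_def)
  qed
  then have \<mu>: "\<mu> \<in> fuzzy_sets k a X" by (auto simp: fuzzy_sets_def \<mu>_def)
  have im: "\<mu> ` X = \<theta> ` f ` X" by (auto simp: \<mu>_def)
  have "\<mu> ` X \<inter> {0<..<1} = \<theta> ` (f ` X \<inter> {1..m})"
    using inner fX by (auto simp: im)
  moreover have "inj_on \<theta> (f ` X \<inter> {1..m})" using inj by (rule inj_on_subset) auto
  ultimately have l: "card (\<mu> ` X \<inter> {0<..<1}) = l" using f(2) by (simp add: card_image)
  \<comment> \<open>No rank is left over: each is 0, lies in \<open>C\<close>, or is a value of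
    \<open>f\<close>. Hence the grid exhausts the image of \<open>\<theta>\<close>.\<close>
  have "q \<in> insert 0 C \<union> f ` X" if "q \<le> Suc m" for q
    using that by (cases "q = 0"; cases "q = Suc m") (simp_all add: C_def)
  then have "{0..Suc m} \<subseteq> insert 0 C \<union> f ` X" by (simp add: subset_eq)
  moreover have "C \<subseteq> {0..Suc m}" using C(1) by (rule subset_trans) simp
  moreover have "f ` X \<subseteq> {0..Suc m}" using fX by (simp add: image_subset_iff)
  ultimately have "{0..Suc m} = insert 0 C \<union> f ` X"
    by (intro equalityI Un_least insert_subsetI) simp_all
  then have "\<theta> ` {0..Suc m} = insert (\<theta> 0) (\<theta> ` C) \<union> \<theta> ` f ` X"
    by (simp only: image_Un image_insert)
  moreover have "a ` {0..Suc k} = insert 0 (a ` {1..Suc k})"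
    using spike_0 by (metis One_nat_def atLeastAtMost_insertL image_insert le0)
  ultimately have "grid k a X \<mu> = \<theta> ` {0..Suc m}"
    by (simp only: grid_def im \<theta>C \<theta>0)
  moreover have "rank_in {0..Suc m} q = q" if "q \<le> Suc m" for q
  proof -
    have "{w \<in> {0..Suc m}. w < q} = {..<q}" using that by auto
    then show ?thesis by (simp add: rank_in_def)
  qed
  ultimately have "rank_in (grid k a X \<mu>) (\<mu> x) = f x" if "x \<in> X" for x
    using rank_in_image[OF mono, of "f x"] fX[OF that] that by (simp add: \<mu>_def)
  then have "code k a X \<mu> = p"
    using f(1) l by (auto simp: code_def p PiE_iff intro!: extensionalityI[of _ X])
  with \<mu> show ?thesis by blast
qed

section \<open>Counting the classes\<close>

lemma code_eq_iff:
  assumes "\<mu> \<in> fuzzy_sets k a X" "\<nu> \<in> fuzzy_sets k a X"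
  shows "code k a X \<mu> = code k a X \<nu> \<longleftrightarrow> fuzzy_equiv k a X \<mu> \<nu>"
  using assms same_orderI_code_eq code_eqI_same_order same_orderI_fuzzy_equiv fuzzy_equivI_same_order
  by blast

text \<open>The classes are the fibres of \<open>code\<close>; these are non-empty by
  \<open>code_surj\<close>, so distinct codes give distinct classes.\<close>

lemma F2_eq_card_codes: "F2 k a X = card (codes k X)"
proof -
  define h where "h = (\<lambda>p. {\<mu> \<in> fuzzy_sets k a X. p = code k a X \<mu>})"
  have "fuzzy_rel k a X `` {\<mu>} = h (code k a X \<mu>)" if "\<mu> \<in> fuzzy_sets k a X" for \<mu>
    using that code_eq_iff[OF that] by (auto simp: fuzzy_rel_def h_def)
  then have "fuzzy_sets k a X // fuzzy_rel k a X = h ` code k a X ` fuzzy_sets k a X"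
    by (auto simp: quotient_def)
  also have "code k a X ` fuzzy_sets k a X = codes k X"
    using code_in_codes code_surj by blast
  finally have "fuzzy_sets k a X // fuzzy_rel k a X = h ` codes k X" .
  moreover have "inj_on h (codes k X)"
  proof (rule inj_onI)
    fix p q assume "p \<in> codes k X" "h p = h q"
    then obtain \<mu> where "\<mu> \<in> fuzzy_sets k a X" "p = code k a X \<mu>" using code_surj by metis
    then have "\<mu> \<in> h p" by (simp add: h_def)
    with \<open>h p = h q\<close> have "\<mu> \<in> h q" by simp
    with \<open>\<mu> \<in> h p\<close> show "p = q" by (simp add: h_def)
  qed
  ultimately show ?thesis by (simp add: F2_def card_image)
qed

end

theorem theorem3p3:
  fixes n k :: nat and X :: "'a set" and a :: "nat \<Rightarrow> real"
  assumes "finite X" and "card X = n" and "spikes k a"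
  shows "F2 k a X =
    (\<Sum>i=0..n. (n choose i) * (\<Sum>l=0..i. fact l * Stirling i l * ((k + l) choose l)) * 2 ^ (n - i))"
proof -
  define T where "T i l = (n choose i) * 2 ^ (n - i) * (fact l * Stirling i l * ((k + l) choose l))" for i l
  have "card {f \<in> X \<rightarrow>\<^sub>E {0..Suc (k + l)}. card (f ` X \<inter> {1..k + l}) = l} = (\<Sum>i\<le>n. T i l)" for l
  proof -
    \<comment> \<open>The two end ranks are the source of the base 2.\<close>
    have "{0..Suc (k + l)} - {1..k + l} = {0, Suc (k + l)}" by auto
    then show ?thesis
      using card_PiE_image_Int[of X "{0..Suc (k + l)}" "{1..k + l}" l] assms
      by (simp add: T_def sum_distrib_left mult_ac numeral_2_eq_2)
  qed
  moreover have "finite {f \<in> X \<rightarrow>\<^sub>E {0..Suc (k + l)}. card (f ` X \<inter> {1..k + l}) = l}" for l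
    using assms by (simp add: finite_PiE)
  ultimately have "F2 k a X = (\<Sum>l\<le>n. \<Sum>i\<le>n. T i l)"
    using F2_eq_card_codes[OF assms(3,1)] assms by (simp add: codes_def)
  also have "\<dots> = (\<Sum>i\<le>n. \<Sum>l\<le>n. T i l)" by (rule sum.swap)
  \<comment> \<open>\<open>Stirling i l\<close> vanishes for \<open>l > i\<close>.\<close>
  also have "\<dots> = (\<Sum>i\<le>n. \<Sum>l\<le>i. T i l)"
    by (intro sum.cong[OF refl] sum.mono_neutral_right) (auto simp: T_def)
  also have "\<dots> = (\<Sum>i=0..n. (n choose i) * (\<Sum>l=0..i. fact l * Stirling i l * ((k + l) choose l)) * 2 ^ (n - i))"
    by (simp add: T_def sum_distrib_left sum_distrib_right mult_ac atLeast0AtMost)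
  finally show ?thesis .
qed

end
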